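(* Let $n\ge 2$, let $\mathcal{P}_n$ be the semigroup, under composition $\circ$, of balanced presentations of the trivial group on the generators $x_1,\dots,x_n$, and let $K$ be a subset of $\mathcal{P}_n$. Then every presentation in the subsemigroup $\langle K\rangle$ of $\mathcal{P}_n$ generated by $K$ satisfies the Andrews-Curtis conjecture if and only if every presentation in $K$ does.
   Context: Let $F$ be the free group on $X=\{x_1,\dots,x_n\}$. A balanced presentation on $x_1,\dots,x_n$ is $P=\langle X\mid r_1,\dots,r_n\rangle$ with an ordered $n$-tuple of relators $r_i=r_i(x_1,\dots,x_n)\in F$ (reordering the relators gives a different presentation). For $P=\langle X\mid r_1,\dots,r_n\rangle$ and $Q=\langle X\mid s_1,\dots,s_n\rangle$, the composition is $P\circ Q=\langle X\mid r_1(S),\dots,r_n(S)\rangle$, where $r_i(S)$ is obtained from $r_i$ by replacing each $x_j$ by $s_j$; $\mathcal{P}_n$ is a semigroup under $\circ$. For a tuple $Y=(y_1,\dots,y_m)$ of elements of $F$, consider the elementary transformations: (AC1) replace $y_i$ by $y_iy_j$ for some $j\ne i$; (AC2) replace $y_i$ by $y_i^{-1}$; (AC3) replace $y_i$ by $g y_i g^{-1}$ for some $g\in F$; in each case all other entries are unchanged. Two tuples are AC-equivalent if one can be obtained from the other by a finite sequence of transformations (AC1)-(AC3). A presentation in $\mathcal{P}_n$ satisfies the Andrews-Curtis conjecture if its tuple of relators is AC-equivalent to $(x_1,\dots,x_n)$. *)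

theory Defs
  imports "HOL-Algebra.Coset" "HOL-Algebra.Elementary_Groups"
begin

section \<open>The free group on \<open>n\<close> generators\<close>

text \<open>
  The letter \<open>(i, True)\<close> stands for the generator with index \<open>i\<close> and \<open>(i, False)\<close> for its
  inverse; the generators are indexed by \<open>0, \<dots>, n - 1\<close>.
\<close>

type_synonym letter = "nat \<times> bool"

definition flip :: "letter \<Rightarrow> letter" where
  "flip a = (fst a, \<not> snd a)"

definition reduced :: "letter list \<Rightarrow> bool" where
  "reduced = successively (\<lambda>a b. b \<noteq> flip a)"

fun push :: "letter \<Rightarrow> letter list \<Rightarrow> letter list" where
  "push a [] = [a]"
| "push a (b # w) = (if b = flip a then w else a # b # w)"

text \<open>
  The elements are the reduced words. For reduced \<open>v\<close>, the word \<open>foldr push u v\<close> is the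
  reduced form of the concatenation \<open>u @ v\<close>.
\<close>

definition free_group :: "nat \<Rightarrow> letter list monoid" where
  "free_group n =
    \<lparr>carrier = {w. reduced w \<and> fst ` set w \<subseteq> {..<n}}, mult = foldr push, one = []\<rparr>"

definition generators :: "nat \<Rightarrow> letter list list" where
  "generators n = map (\<lambda>i. [(i, True)]) [0..<n]"

lemma flip_flip [simp]: "flip (flip a) = a"
  by (simp add: flip_def)

lemma fst_flip [simp]: "fst (flip a) = fst a"
  by (simp add: flip_def)

lemma flip_neq [simp]: "flip a \<noteq> a" "a \<noteq> flip a"
  by (cases a; simp add: flip_def)+

lemma reduced_Nil [simp]: "reduced []"
  by (simp add: reduced_def)

lemma reduced_Cons: "reduced (a # w) \<longleftrightarrow> (w = [] \<or> hd w \<noteq> flip a) \<and> reduced w"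
  by (auto simp: reduced_def successively_Cons)

lemma reduced_push: "reduced w \<Longrightarrow> reduced (push a w)"
  by (cases w) (auto simp: reduced_Cons)

lemma set_push: "set (push a w) \<subseteq> insert a (set w)"
  by (cases w) auto

lemma push_push_flip: "reduced w \<Longrightarrow> push a (push (flip a) w) = w"
  by (cases w rule: list.exhaust; cases "tl w") (auto simp: reduced_Cons)

lemma reduced_foldr_push: "reduced v \<Longrightarrow> reduced (foldr push u v)"
  by (induction u) (auto intro: reduced_push)

lemma foldr_push_closed:
  "fst ` set u \<subseteq> A \<Longrightarrow> fst ` set v \<subseteq> A \<Longrightarrow> fst ` set (foldr push u v) \<subseteq> A"
proof (induction u)
  case (Cons a u)
  then show ?case using set_push[of a "foldr push u v"] by force
qed simp

lemma foldr_push_push: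
  assumes "reduced w"
  shows "foldr push (push a v) w = push a (foldr push v w)"
proof (cases v)
  case (Cons b v')
  then show ?thesis
    using push_push_flip[OF reduced_foldr_push[OF assms], of a v'] by auto
qed simp

lemma foldr_push_assoc:
  assumes "reduced w"
  shows "foldr push (foldr push u v) w = foldr push u (foldr push v w)"
  by (induction u) (simp_all add: foldr_push_push assms)

lemma foldr_push_Nil: "reduced u \<Longrightarrow> foldr push u [] = u"
proof (induction u)
  case (Cons a u)
  then show ?case by (cases u) (auto simp: reduced_Cons)
qed simp

lemma foldr_push_inverse: "foldr push (rev (map flip u)) u = []"
  by (induction u) auto

lemma reduced_inverse: "reduced u \<Longrightarrow> reduced (rev (map flip u))"
  unfolding reduced_def successively_rev successively_map flip_flip
  by (erule successively_mono) auto

lemma group_free_group: "group (free_group n)"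
proof (rule groupI)
  fix x assume x: "x \<in> carrier (free_group n)"
  show "\<exists>y\<in>carrier (free_group n). y \<otimes>\<^bsub>free_group n\<^esub> x = \<one>\<^bsub>free_group n\<^esub>"
    using x
    by (intro bexI[of _ "rev (map flip x)"])
      (auto simp: free_group_def foldr_push_inverse reduced_inverse)
next
  fix x y assume "x \<in> carrier (free_group n)" "y \<in> carrier (free_group n)"
  then show "x \<otimes>\<^bsub>free_group n\<^esub> y \<in> carrier (free_group n)"
    using foldr_push_closed[of x "{..<n}" y] by (auto simp: free_group_def reduced_foldr_push)
qed (auto simp: free_group_def foldr_push_assoc)


section \<open>Balanced presentations\<close>

text \<open>
  A presentation is the list of its relators, so the order and repetitions of the relators matter.
\<close>

definition normal_closure :: "('a, 'b) monoid_scheme \<Rightarrow> 'a set \<Rightarrow> 'a set" where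
  "normal_closure G A = \<Inter> {N. N \<lhd> G \<and> A \<subseteq> N}"

definition presented_group :: "nat \<Rightarrow> letter list list \<Rightarrow> letter list set monoid" where
  "presented_group n R = free_group n Mod normal_closure (free_group n) (set R)"

definition balanced_presentations :: "nat \<Rightarrow> letter list list set" where
  "balanced_presentations n = {R. length R = n \<and> set R \<subseteq> carrier (free_group n)}"

definition trivial_balanced_presentations :: "nat \<Rightarrow> letter list list set" where
  "trivial_balanced_presentations n =
    {R \<in> balanced_presentations n. trivial_group (presented_group n R)}"

text \<open>\<open>substitute G S w\<close> is \<open>w(S)\<close>, evaluated in \<open>G\<close>.\<close>

definition letter_value :: "('a, 'b) monoid_scheme \<Rightarrow> 'a list \<Rightarrow> letter \<Rightarrow> 'a" where
  "letter_value G S a = (if snd a then S ! fst a else inv\<^bsub>G\<^esub> (S ! fst a))"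

definition substitute :: "('a, 'b) monoid_scheme \<Rightarrow> 'a list \<Rightarrow> letter list \<Rightarrow> 'a" where
  "substitute G S w = foldr (\<lambda>a g. letter_value G S a \<otimes>\<^bsub>G\<^esub> g) w \<one>\<^bsub>G\<^esub>"

definition compose_presentations :: "nat \<Rightarrow> letter list list \<Rightarrow> letter list list \<Rightarrow> letter list list" where
  "compose_presentations n P Q = map (substitute (free_group n) Q) P"

inductive_set generated_subsemigroup :: "('a \<Rightarrow> 'a \<Rightarrow> 'a) \<Rightarrow> 'a set \<Rightarrow> 'a set"
  for f :: "'a \<Rightarrow> 'a \<Rightarrow> 'a" and K :: "'a set" where
  base: "p \<in> K \<Longrightarrow> p \<in> generated_subsemigroup f K"
| mult: "p \<in> generated_subsemigroup f K \<Longrightarrow> q \<in> generated_subsemigroup f K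
    \<Longrightarrow> f p q \<in> generated_subsemigroup f K"


section \<open>Andrews--Curtis transformations\<close>

inductive ac_step :: "('a, 'b) monoid_scheme \<Rightarrow> 'a list \<Rightarrow> 'a list \<Rightarrow> bool"
  for G :: "('a, 'b) monoid_scheme" where
  AC1: "i < length Y \<Longrightarrow> j < length Y \<Longrightarrow> j \<noteq> i \<Longrightarrow> ac_step G Y (Y[i := Y ! i \<otimes>\<^bsub>G\<^esub> Y ! j])"
| AC2: "i < length Y \<Longrightarrow> ac_step G Y (Y[i := inv\<^bsub>G\<^esub> (Y ! i)])"
| AC3: "i < length Y \<Longrightarrow> g \<in> carrier G
    \<Longrightarrow> ac_step G Y (Y[i := g \<otimes>\<^bsub>G\<^esub> Y ! i \<otimes>\<^bsub>G\<^esub> inv\<^bsub>G\<^esub> g])"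

text \<open>
  Every transformation is undone by a sequence of transformations, so on tuples over a group
  this relation is symmetric.
\<close>

definition ac_equivalent :: "('a, 'b) monoid_scheme \<Rightarrow> 'a list \<Rightarrow> 'a list \<Rightarrow> bool" where
  "ac_equivalent G = (ac_step G)\<^sup>*\<^sup>*"

definition satisfies_andrews_curtis :: "nat \<Rightarrow> letter list list \<Rightarrow> bool" where
  "satisfies_andrews_curtis n P \<longleftrightarrow> ac_equivalent (free_group n) P (generators n)"


section \<open>The semigroup of balanced presentations of the trivial group\<close>

lemma substitute_Nil: "substitute G S [] = \<one>\<^bsub>G\<^esub>"
  by (simp add: substitute_def)

lemma substitute_Cons: "substitute G S (a # w) = letter_value G S a \<otimes>\<^bsub>G\<^esub> substitute G S w"
  by (simp add: substitute_def)

lemma (in group) normal_closure_normal: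
  assumes "A \<subseteq> carrier G"
  shows "normal_closure G A \<lhd> G"
proof -
  let ?F = "{N. N \<lhd> G \<and> A \<subseteq> N}"
  have "carrier G \<lhd> G"
    unfolding normal_inv_iff by (simp add: subgroup_self)
  then have mem: "carrier G \<in> ?F" using assms by blast
  have "subgroup (\<Inter> ?F) G"
    using mem by (intro subgroups_Inter) (auto dest: normal_imp_subgroup)
  then show ?thesis
    unfolding normal_closure_def normal_inv_iff
    by (auto intro: normal.inv_op_closed2)
qed

lemma normal_closure_superset: "A \<subseteq> normal_closure G A"
  by (auto simp: normal_closure_def)

lemma normal_closure_least: "N \<lhd> G \<Longrightarrow> A \<subseteq> N \<Longrightarrow> normal_closure G A \<subseteq> N"
  by (auto simp: normal_closure_def)

lemma (in group) trivial_factgroup_iff: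
  assumes "N \<lhd> G"
  shows "trivial_group (G Mod N) \<longleftrightarrow> N = carrier G"
proof
  assume "trivial_group (G Mod N)"
  then have *: "N #> x = N" if "x \<in> carrier G" for x
    using that by (auto simp: trivial_group_def FactGroup_def RCOSETS_def)
  have "x \<in> N" if "x \<in> carrier G" for x
    using *[OF that] rcos_self[OF that normal_imp_subgroup[OF assms]] by simp
  then show "N = carrier G"
    using normal_imp_subgroup[OF assms] by (auto dest: subgroup.mem_carrier)
next
  assume N: "N = carrier G"
  have "carrier (G Mod N) = {N}"
    using N coset_join2[of _ N] normal_imp_subgroup[OF assms]
    by (auto simp: FactGroup_def RCOSETS_def)
  then show "trivial_group (G Mod N)"
    using normal.factorgroup_is_group[OF assms] by (simp add: trivial_group_def FactGroup_def)
qed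

lemma trivial_balanced_presentations_iff:
  "R \<in> trivial_balanced_presentations n \<longleftrightarrow>
    R \<in> balanced_presentations n \<and>
    normal_closure (free_group n) (set R) = carrier (free_group n)"
  using group.trivial_factgroup_iff[OF group_free_group
      group.normal_closure_normal[OF group_free_group]]
  by (auto simp: trivial_balanced_presentations_def presented_group_def balanced_presentations_def)

context group
begin

context
  fixes S :: "'a list" and n :: nat
  assumes S: "length S = n" "set S \<subseteq> carrier G"
begin

lemma nth_closed: "i < n \<Longrightarrow> S ! i \<in> carrier G"
  using S nth_mem[of i S] by blast

lemma letter_value_closed: "fst a < n \<Longrightarrow> letter_value G S a \<in> carrier G"
  using nth_closed[of "fst a"] by (simp add: letter_value_def)

lemma substitute_closed: "fst ` set w \<subseteq> {..<n} \<Longrightarrow> substitute G S w \<in> carrier G"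
  by (induction w) (auto simp: substitute_def letter_value_closed)

lemma letter_value_flip: "fst a < n \<Longrightarrow> letter_value G S (flip a) = inv (letter_value G S a)"
  using nth_closed[of "fst a"] by (simp add: letter_value_def flip_def)

lemma substitute_push:
  assumes "fst a < n" "fst ` set w \<subseteq> {..<n}"
  shows "substitute G S (push a w) = letter_value G S a \<otimes> substitute G S w"
proof (cases w)
  case (Cons b v)
  have "letter_value G S a \<otimes> (letter_value G S (flip a) \<otimes> substitute G S v) = substitute G S v"
    using assms Cons letter_value_closed[of a] substitute_closed[of v]
    by (simp add: letter_value_flip m_assoc[symmetric])
  then show ?thesis using Cons by (auto simp: substitute_def)
qed (simp add: substitute_def)

lemma substitute_mult:
  assumes "fst ` set u \<subseteq> {..<n}" "fst ` set v \<subseteq> {..<n}"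
  shows "substitute G S (foldr push u v) = substitute G S u \<otimes> substitute G S v"
  using assms(1)
proof (induction u)
  case Nil
  then show ?case using assms(2) substitute_closed[of v] by (simp add: substitute_def)
next
  case (Cons a u)
  then have "substitute G S (push a (foldr push u v))
      = letter_value G S a \<otimes> (substitute G S u \<otimes> substitute G S v)"
    using foldr_push_closed[of u "{..<n}" v] assms(2) by (simp add: substitute_push)
  also have "\<dots> = substitute G S (a # u) \<otimes> substitute G S v"
    using Cons.prems assms(2) letter_value_closed[of a] substitute_closed[of u]
      substitute_closed[of v]
    by (simp add: substitute_def m_assoc)
  finally show ?case by simp
qed

lemma substitute_hom: "substitute G S \<in> hom (free_group n) G"
  by (rule homI) (auto simp: free_group_def intro!: substitute_closed substitute_mult)

lemma substitute_generator: "i < n \<Longrightarrow> substitute G S (generators n ! i) = S ! i"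
  using nth_closed[of i] by (simp add: generators_def substitute_def letter_value_def)

end

end

lemma substitute_generators:
  assumes "w \<in> carrier (free_group n)"
  shows "substitute (free_group n) (generators n) w = w"
proof -
  interpret F: group "free_group n" by (rule group_free_group)
  have gen: "[(i, True)] \<in> carrier (free_group n)" if "i < n" for i
    using that by (simp add: free_group_def reduced_Cons)
  have inv: "inv\<^bsub>free_group n\<^esub> [(i, True)] = [(i, False)]" if "i < n" for i
    using that gen[OF that]
    by (intro F.inv_equality) (auto simp: free_group_def reduced_Cons flip_def)
  have lv: "letter_value (free_group n) (generators n) a = [a]" if "fst a < n" for a
    using that inv[of "fst a"] by (cases a) (auto simp: letter_value_def generators_def)
  have "substitute (free_group n) (generators n) u = foldr push u []"
    if "fst ` set u \<subseteq> {..<n}" for u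
    using that
    by (induction u) (simp_all add: substitute_def lv, simp_all add: free_group_def)
  then show ?thesis using assms by (simp add: foldr_push_Nil free_group_def)
qed

lemma compose_presentations_closed:
  assumes P: "P \<in> trivial_balanced_presentations n" and Q: "Q \<in> trivial_balanced_presentations n"
  shows "compose_presentations n P Q \<in> trivial_balanced_presentations n"
proof -
  interpret F: group "free_group n" by (rule group_free_group)
  let ?F = "free_group n" and ?s = "substitute (free_group n) Q"
  have PF: "length P = n" "set P \<subseteq> carrier ?F" and QF: "length Q = n" "set Q \<subseteq> carrier ?F"
    using P Q by (auto simp: trivial_balanced_presentations_def balanced_presentations_def)
  have hom: "?s \<in> hom ?F ?F" using F.substitute_hom[OF QF] .
  then interpret H: group_hom ?F ?F ?s by unfold_locales
  have RF: "set (compose_presentations n P Q) \<subseteq> carrier ?F"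
    using PF(2) H.hom_closed by (auto simp: compose_presentations_def)
  let ?N = "normal_closure ?F (set (compose_presentations n P Q))"
  have N: "?N \<lhd> ?F" using F.normal_closure_normal[OF RF] .
  have NF: "?N \<subseteq> carrier ?F"
    using normal_imp_subgroup[OF N] by (auto dest: subgroup.mem_carrier)
  let ?M = "{w \<in> carrier ?F. ?s w \<in> ?N}"
  have "?M \<lhd> ?F"
    unfolding F.normal_inv_iff
  proof
    have N': "subgroup ?N ?F" using normal_imp_subgroup[OF N] .
    show "subgroup ?M ?F"
    proof (rule F.subgroupI)
      show "?M \<noteq> {}"
        using subgroup.one_closed[OF N'] by (auto intro!: exI[of _ "\<one>\<^bsub>?F\<^esub>"])
    qed (use subgroup.m_closed[OF N'] subgroup.m_inv_closed[OF N'] in auto)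
    show "\<forall>x\<in>carrier ?F. \<forall>h\<in>?M. x \<otimes>\<^bsub>?F\<^esub> h \<otimes>\<^bsub>?F\<^esub> inv\<^bsub>?F\<^esub> x \<in> ?M"
      using normal.inv_op_closed2[OF N] by auto
  qed
  moreover have "set P \<subseteq> ?M"
    using PF normal_closure_superset[of "set (compose_presentations n P Q)" ?F]
    by (auto simp: compose_presentations_def)
  ultimately have "normal_closure ?F (set P) \<subseteq> ?M"
    by (rule normal_closure_least)
  then have M: "carrier ?F \<subseteq> ?M"
    using P unfolding trivial_balanced_presentations_iff by simp
  have "set Q \<subseteq> ?N"
  proof
    fix q assume "q \<in> set Q"
    then obtain i where i: "i < n" "q = Q ! i" using QF by (auto simp: in_set_conv_nth)
    have "generators n ! i \<in> carrier ?F"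
      using i by (simp add: generators_def free_group_def reduced_Cons)
    then show "q \<in> ?N" using M F.substitute_generator[OF QF i(1)] i by auto
  qed
  then have "normal_closure ?F (set Q) \<subseteq> ?N"
    by (rule normal_closure_least[OF N])
  then have "carrier ?F \<subseteq> ?N"
    using Q unfolding trivial_balanced_presentations_iff by simp
  then have "?N = carrier ?F" using NF by (rule subset_antisym[rotated])
  moreover have "length (compose_presentations n P Q) = n"
    using PF by (simp add: compose_presentations_def)
  ultimately show ?thesis
    using RF unfolding trivial_balanced_presentations_iff balanced_presentations_def by simp
qed

lemma compose_presentations_assoc:
  assumes P: "P \<in> balanced_presentations n"
    and Q: "Q \<in> balanced_presentations n" and R: "R \<in> balanced_presentations n"
  shows "compose_presentations n (compose_presentations n P Q) R = compose_presentations n P (compose_presentations n Q R)"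
proof -
  interpret F: group "free_group n" by (rule group_free_group)
  let ?F = "free_group n" and ?QR = "compose_presentations n Q R"
  have QF: "length Q = n" "set Q \<subseteq> carrier ?F" and RF: "length R = n" "set R \<subseteq> carrier ?F"
    and PF: "set P \<subseteq> carrier ?F"
    using P Q R by (auto simp: balanced_presentations_def)
  have "substitute ?F R \<in> hom ?F ?F" using F.substitute_hom[OF RF] .
  then interpret H: group_hom ?F ?F "substitute ?F R" by unfold_locales
  have lv: "substitute ?F R (letter_value ?F Q a) = letter_value ?F ?QR a" if "fst a < n" for a
  proof -
    have "Q ! fst a \<in> carrier ?F" using QF that nth_mem[of "fst a" Q] by auto
    then show ?thesis using that QF by (simp add: letter_value_def compose_presentations_def)
  qed
  have "substitute ?F R (substitute ?F Q w) = substitute ?F ?QR w"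
    if "fst ` set w \<subseteq> {..<n}" for w
    using that
  proof (induction w)
    case (Cons a w)
    then show ?case
      using lv[of a] F.letter_value_closed[OF QF, of a] F.substitute_closed[OF QF, of w]
      by (simp add: substitute_Cons)
  qed (simp add: substitute_Nil)
  moreover have "fst ` set p \<subseteq> {..<n}" if "p \<in> set P" for p
    using PF that by (auto simp: free_group_def)
  ultimately show ?thesis by (simp add: compose_presentations_def)
qed

end

(* A homomorphism carries each Andrews-Curtis transformation to one of the same kind, so applying
   the endomorphism x_j |-> s_j of the free group to a sequence of transformations from P to the
   generators gives one from the composition of P and Q to Q, which then continues to the
   generators. *)
theory Submission
  imports Defs
begin

text \<open>The laws of a homomorphism are available only on the carrier, so transporting a whole
  sequence of transformations needs every intermediate tuple to stay inside it.\<close>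

lemma (in group) ac_step_closed:
  assumes "ac_step G Y Z" "set Y \<subseteq> carrier G"
  shows "set Z \<subseteq> carrier G"
  using assms
proof cases
  case (AC1 i j)
  then have "Y ! i \<otimes> Y ! j \<in> carrier G" using assms(2) by (auto simp: subset_iff)
  then show ?thesis using AC1(1) assms(2) set_update_subset_insert by fastforce
next
  case (AC2 i)
  then have "inv (Y ! i) \<in> carrier G" using assms(2) by (auto simp: subset_iff)
  then show ?thesis using AC2(1) assms(2) set_update_subset_insert by fastforce
next
  case (AC3 i g)
  then have "g \<otimes> Y ! i \<otimes> inv g \<in> carrier G" using assms(2) by (auto simp: subset_iff)
  then show ?thesis using AC3(1) assms(2) set_update_subset_insert by fastforce
qed

text \<open>Updating one entry commutes with \<open>map h\<close>, and \<open>h\<close> respects the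
  product, inverse or conjugate that is written there; the positions \<open>i\<close> and
  \<open>j\<close> stay the same.\<close>

lemma (in group_hom) ac_step_map:
  assumes "ac_step G Y Z" "set Y \<subseteq> carrier G"
  shows "ac_step H (map h Y) (map h Z)"
  using assms(1)
proof cases
  case (AC1 i j)
  then have "Y ! i \<in> carrier G" "Y ! j \<in> carrier G" using assms(2) by (auto simp: subset_iff)
  then show ?thesis using AC1 ac_step.AC1[of i "map h Y" j H] by (simp add: map_update)
next
  case (AC2 i)
  then have "Y ! i \<in> carrier G" using assms(2) by (auto simp: subset_iff)
  then show ?thesis using AC2 ac_step.AC2[of i "map h Y" H] by (simp add: map_update)
next
  case (AC3 i g)
  then have "Y ! i \<in> carrier G" using assms(2) by (auto simp: subset_iff)
  \<comment> \<open>The conjugator \<open>g\<close> turns into \<open>h g\<close>, which lies in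
    \<open>carrier H\<close>.\<close>
  then show ?thesis using AC3 ac_step.AC3[of i "map h Y" "h g" H] by (simp add: map_update)
qed

lemma (in group_hom) ac_equivalent_map:
  assumes "ac_equivalent G Y Z" "set Y \<subseteq> carrier G"
  shows "ac_equivalent H (map h Y) (map h Z)"
  using assms unfolding ac_equivalent_def
\<comment> \<open>The first transformation is split off, since closedness is known at the start
  \<open>Y\<close> and passes forward to \<open>Y'\<close>.\<close>
proof (induction rule: converse_rtranclp_induct)
  case (step Y Y')
  then show ?case
    using ac_step_map G.ac_step_closed by (meson converse_rtranclp_into_rtranclp)
qed simp

text \<open>This identifies the endpoint of the transported sequence: evaluating the word of a
  single generator at \<open>Q\<close> returns the matching entry of \<open>Q\<close>.\<close>

lemma compose_presentations_generators:
  assumes "Q \<in> balanced_presentations n"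
  shows "compose_presentations n (generators n) Q = Q"
proof (rule nth_equalityI)
  have Q: "length Q = n" "set Q \<subseteq> carrier (free_group n)"
    using assms by (auto simp: balanced_presentations_def)
  show "length (compose_presentations n (generators n) Q) = length Q"
    using Q by (simp add: compose_presentations_def generators_def)
  fix i assume "i < length (compose_presentations n (generators n) Q)"
  then have i: "i < length (generators n)" "i < n"
    by (simp_all add: compose_presentations_def generators_def)
  show "compose_presentations n (generators n) Q ! i = Q ! i"
    unfolding compose_presentations_def nth_map[OF i(1)]
    by (rule group.substitute_generator[OF group_free_group Q i(2)])
qed

lemma satisfies_andrews_curtis_compose:
  assumes P: "P \<in> balanced_presentations n" "satisfies_andrews_curtis n P"
    and Q: "Q \<in> balanced_presentations n" "satisfies_andrews_curtis n Q"
  shows "satisfies_andrews_curtis n (compose_presentations n P Q)"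
proof -
  let ?F = "free_group n"
  have "substitute ?F Q \<in> hom ?F ?F"
    using Q(1) by (intro group.substitute_hom group_free_group) (auto simp: balanced_presentations_def)
  then interpret group_hom ?F ?F "substitute ?F Q"
    by (simp add: group_hom_def group_hom_axioms_def group_free_group)
  \<comment> \<open>Composition with \<open>Q\<close> on the right is by definition the entrywise
    image under the endomorphism, so both ends of the transported sequence are compositions.\<close>
  have "ac_equivalent ?F (compose_presentations n P Q) (compose_presentations n (generators n) Q)"
    using P ac_equivalent_map unfolding compose_presentations_def
    by (simp add: satisfies_andrews_curtis_def balanced_presentations_def)
  then have "ac_equivalent ?F (compose_presentations n P Q) Q"
    using Q(1) by (simp add: compose_presentations_generators)
  then show ?thesis
    using Q(2) unfolding satisfies_andrews_curtis_def ac_equivalent_def by (rule rtranclp_trans)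
qed

theorem proposition1p5:
  fixes n :: nat and K :: "letter list list set"
  assumes "n \<ge> 2"
    and "K \<subseteq> trivial_balanced_presentations n"
  shows "(\<forall>P \<in> generated_subsemigroup (compose_presentations n) K. satisfies_andrews_curtis n P)
    \<longleftrightarrow> (\<forall>P \<in> K. satisfies_andrews_curtis n P)"
proof
  assume "\<forall>P \<in> generated_subsemigroup (compose_presentations n) K. satisfies_andrews_curtis n P"
  then show "\<forall>P \<in> K. satisfies_andrews_curtis n P"
    by (auto intro: generated_subsemigroup.base)
next
  assume K: "\<forall>P \<in> K. satisfies_andrews_curtis n P"
  \<comment> \<open>Membership is carried through the induction because the composition lemma asks
    for both factors to be balanced.\<close>
  have "P \<in> trivial_balanced_presentations n \<and> satisfies_andrews_curtis n P"
    if "P \<in> generated_subsemigroup (compose_presentations n) K" for P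
    using that
  proof induction
    case (base P)
    then show ?case using K assms(2) by blast
  next
    case (mult P Q)
    then show ?case
      by (simp add: compose_presentations_closed satisfies_andrews_curtis_compose
          trivial_balanced_presentations_iff[THEN iffD1])
  qed
  then show "\<forall>P \<in> generated_subsemigroup (compose_presentations n) K. satisfies_andrews_curtis n P"
    by blast
qed

end
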